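(* Let $1\le p<q\le\infty$ and $\theta\in\,]0,1[$, and define $p_\theta$ by $\frac1{p_\theta}=\frac{\theta}{p}+\frac{1-\theta}{q}$. Then for all $\mu,\nu\in\mathcal{D}_p\cap\mathcal{D}_q$, $$d_{p_\theta}(\mu,\nu)\le 2^{1-\theta}\,d_p(\mu,\nu)^{\theta}\,\bigl(\mathrm{Pers}_q(\mu)+\mathrm{Pers}_q(\nu)\bigr)^{1-\theta}.$$ Consequently, if $p\le r\le q$, then $\mathcal{D}_p\cap\mathcal{D}_q\subset\mathcal{D}_r$.
   Context: Let $\mathcal{X}=\{(x,y)\in\mathbb{R}^2: y>x\}$, $\Delta=\{(x,x):x\in\mathbb{R}\}$ and $\overline{\mathcal{X}}=\mathcal{X}\cup\Delta$, equipped with the metric $d_{\mathbb{R}^2,\infty}((a,b),(c,d))=\max\{|a-c|,|b-d|\}$. $\mathcal{D}$ is the space of (Radon, possibly infinite) measures on $\mathcal{X}$ (persistence measures). The diagonal is treated as a source of infinite mass: $\Gamma(\mu,\nu)$ is the set of measures $\pi$ on $\overline{\mathcal{X}}^2$ such that $\pi(A\times\overline{\mathcal{X}})=\mu(A)$ and $\pi(\overline{\mathcal{X}}\times A)=\nu(A)$ for all Borel $A\subset\mathcal{X}$ (no constraint on the diagonal). For $1\le p<\infty$, $d_p(\mu,\nu)=\bigl[\inf_{\pi\in\Gamma(\mu,\nu)}\int_{\overline{\mathcal{X}}^2}d_{\mathbb{R}^2,\infty}^p(x,y)\,d\pi(x,y)\bigr]^{1/p}$, and $d_\infty(\mu,\nu)=\inf_{\pi\in\Gamma(\mu,\nu)}\sup_{(x,y)\in\mathrm{supp}(\pi)}d_{\mathbb{R}^2,\infty}(x,y)$.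 $\mathrm{Pers}_p(\mu):=d_p(\mu,\Delta)$ is the distance from $\mu$ to the empty diagram (all mass sent to the diagonal); for $p<\infty$, $\mathrm{Pers}_p(\mu)^p=\int_{\mathcal{X}}d_{\mathbb{R}^2,\infty}(z,\Delta)^p\,d\mu(z)$. $\mathcal{D}_p:=\{\mu\in\mathcal{D}:\mathrm{Pers}_p(\mu)<\infty\}$. *)

theory Defs
  imports "HOL-Analysis.Analysis"
begin

type_synonym point = "real \<times> real"

definition upper :: "point set" where
  "upper = {(x, y). y > x}"

definition diagonal :: "point set" where
  "diagonal = {(x, x) |x. True}"

definition upper_closed :: "point set" where
  "upper_closed = upper \<union> diagonal"

text \<open>The library metric on \<^typ>\<open>real \<times> real\<close> is Euclidean, so the sup metric is written out. It
  induces the same topology, hence \<^const>\<open>borel\<close>, \<^const>\<open>compact\<close> and \<^const>\<open>open\<close> may be used as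
  they stand.\<close>

definition dist_sup :: "point \<Rightarrow> point \<Rightarrow> real" where
  "dist_sup z w = max \<bar>fst z - fst w\<bar> \<bar>snd z - snd w\<bar>"

text \<open>Radon measures on the open half-plane: Borel measures of the subspace that are finite on its
  compact subsets and inner regular.\<close>

definition persistence_measures :: "point measure set" where
  "persistence_measures = {\<mu>.
     sets \<mu> = sets (restrict_space borel upper) \<and>
     (\<forall>K. compact K \<and> K \<subseteq> upper \<longrightarrow> emeasure \<mu> K < \<infinity>) \<and>
     (\<forall>A \<in> sets \<mu>. emeasure \<mu> A = (SUP K \<in> {K. compact K \<and> K \<subseteq> A}. emeasure \<mu> K))}"

definition empty_diagram :: "point measure" where
  "empty_diagram = null_measure (restrict_space borel upper)"

text \<open>Transport plans are arbitrary Borel measures, not Radon ones: when a measure has infinite mass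
  near the diagonal, even the plan projecting it to the diagonal is not locally finite.\<close>

definition plans :: "point measure \<Rightarrow> point measure \<Rightarrow> (point \<times> point) measure set" where
  "plans \<mu> \<nu> = {\<pi>.
     sets \<pi> = sets (restrict_space borel (upper_closed \<times> upper_closed)) \<and>
     (\<forall>A \<in> sets (restrict_space borel upper).
        emeasure \<pi> (A \<times> upper_closed) = emeasure \<mu> A \<and>
        emeasure \<pi> (upper_closed \<times> A) = emeasure \<nu> A)}"

definition measure_support :: "'a::topological_space measure \<Rightarrow> 'a set" where
  "measure_support M =
     {z \<in> space M. \<forall>U. open U \<and> z \<in> U \<longrightarrow> emeasure M (U \<inter> space M) > 0}"

text \<open>Real powers of extended nonnegative reals, meant for exponents \<open>a > 0\<close> only.\<close>

definition epowr :: "ennreal \<Rightarrow> real \<Rightarrow> ennreal" where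
  "epowr x a = (if x = \<infinity> then \<infinity> else ennreal (enn2real x powr a))"

text \<open>Exponents range over \<open>[1, \<infinity>]\<close>, as elements of \<^typ>\<open>ennreal\<close>.\<close>

definition pdist :: "ennreal \<Rightarrow> point measure \<Rightarrow> point measure \<Rightarrow> ennreal" where
  "pdist p \<mu> \<nu> =
     (if p = \<infinity>
      then INF \<pi> \<in> plans \<mu> \<nu>. SUP (x, y) \<in> measure_support \<pi>. ennreal (dist_sup x y)
      else epowr (INF \<pi> \<in> plans \<mu> \<nu>. \<integral>\<^sup>+ (x, y). ennreal (dist_sup x y powr enn2real p) \<partial>\<pi>)
             (1 / enn2real p))"

definition Pers :: "ennreal \<Rightarrow> point measure \<Rightarrow> ennreal" where
  "Pers p \<mu> = pdist p \<mu> empty_diagram"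

definition finite_pers :: "ennreal \<Rightarrow> point measure set" where
  "finite_pers p = {\<mu> \<in> persistence_measures. Pers p \<mu> < \<infinity>}"

end

theory Submission
  imports Defs
begin

text \<open>A transport plan may be modified so that, almost everywhere, no mass travels further than the
  sum of the distances of its two endpoints to the diagonal, without increasing its \<open>p\<close>-cost. After
  this modification the \<open>q\<close>-cost is controlled by \<open>Pers q \<mu> + Pers q \<nu>\<close>, and Hoelder's inequality
  interpolates the cost at the intermediate exponent between the \<open>p\<close>-cost and the \<open>q\<close>-cost. The
  inclusion of the spaces is the case where \<open>\<nu>\<close> is the empty diagram.\<close>

subsection \<open>Sums of measures, real powers and the Hoelder inequality\<close>

text \<open>A plan of small \<open>p\<close>-cost may still carry some mass arbitrarily far, and its
  \<open>q\<close>-cost is then not controlled by persistence; hence the modification. It is applied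
  to every plan, so no optimal plan has to exist: infima are taken only at the end, where finiteness
  of \<open>Pers q\<close> enters. Write d for the distance travelled and r for the intermediate
  exponent. With s = r \<theta> / p and t = r (1 - \<theta>) / q, the relation defining r says
  exactly s + t = 1, and Hoelder's inequality is applied to d^r = (d^p)^s (d^q)^t. For infinite q a
  pointwise bound d^r <= b^(r-p) d^p takes its place. Marginals do not see mass on the diagonal, but
  the distance to the diagonal vanishes there, so its integral over a plan is still determined by
  the marginals. The constant 2 arises when the sum of the two endpoint distances is split into
  separate \<open>q\<close>-th powers, one for each marginal.\<close>

definition measure_sum :: "'a measure \<Rightarrow> 'a measure \<Rightarrow> 'a measure" where
  "measure_sum M N = measure_of (space M) (sets M) (\<lambda>A. emeasure M A + emeasure N A)"

lemma sets_measure_sum [simp, measurable_cong]: "sets (measure_sum M N) = sets M"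
  and space_measure_sum [simp]: "space (measure_sum M N) = space M"
  unfolding measure_sum_def by simp_all

lemma emeasure_measure_sum:
  assumes "sets N = sets M" and "A \<in> sets M"
  shows "emeasure (measure_sum M N) A = emeasure M A + emeasure N A"
  unfolding measure_sum_def
proof (rule emeasure_measure_of_sigma)
  show "sigma_algebra (space M) (sets M)" ..
  show "positive (sets M) (\<lambda>A. emeasure M A + emeasure N A)"
    by (simp add: positive_def)
  show "countably_additive (sets M) (\<lambda>A. emeasure M A + emeasure N A)"
    using assms(1) by (auto intro!: countably_additiveI simp: suminf_emeasure simp flip: suminf_add)
qed fact

text \<open>Both sides are additive, homogeneous and continuous along increasing sequences in
  \<open>f\<close>, so indicators decide.\<close>

lemma nn_integral_measure_sum:
  assumes N: "sets N = sets M" and "f \<in> borel_measurable M"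
  shows "(\<integral>\<^sup>+ x. f x \<partial>measure_sum M N) = (\<integral>\<^sup>+ x. f x \<partial>M) + (\<integral>\<^sup>+ x. f x \<partial>N)"
  using assms(2)
proof induct
  case (cong f g)
  have "space N = space M"
    using N by (rule sets_eq_imp_space_eq)
  with cong(3) have "integral\<^sup>N L f = integral\<^sup>N L g" if "L \<in> {M, N, measure_sum M N}" for L
    using that by (intro nn_integral_cong) auto
  with cong show ?case
    by simp
next
  case (set A)
  with N show ?case
    by (simp add: emeasure_measure_sum)
next
  case (mult u c)
  then have "u \<in> borel_measurable N" "u \<in> borel_measurable (measure_sum M N)"
    using N by (simp_all cong: measurable_cong_sets)
  with mult show ?case
    by (simp add: nn_integral_cmult distrib_left)
next
  case (add u v)
  then have "u \<in> borel_measurable N" "v \<in> borel_measurable N"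
    "u \<in> borel_measurable (measure_sum M N)" "v \<in> borel_measurable (measure_sum M N)"
    using N by (simp_all cong: measurable_cong_sets)
  with add show ?case
    by (simp add: nn_integral_add ac_simps)
next
  case (seq U)
  have meas: "U i \<in> borel_measurable N" "U i \<in> borel_measurable (measure_sum M N)" for i
    using N seq by (simp_all cong: measurable_cong_sets)
  have mono: "incseq (\<lambda>i. integral\<^sup>N L (U i))" for L
    using seq(4) by (auto simp: incseq_def le_fun_def intro!: nn_integral_mono)
  show ?case
    using seq meas
    by (simp add: nn_integral_monotone_convergence_SUP image_comp SUP_apply ennreal_SUP_add mono)
qed

section \<open>Powers of extended nonnegative reals and elementary inequalities\<close>

lemma epowr_ennreal: "0 \<le> b \<Longrightarrow> epowr (ennreal b) a = ennreal (b powr a)"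
  by (simp add: epowr_def)

lemma epowr_top [simp]: "epowr top a = top"
  by (simp add: epowr_def)

lemma epowr_zero [simp]: "epowr 0 a = 0"
  by (simp add: epowr_def)

lemma epowr_mono: "0 \<le> a \<Longrightarrow> x \<le> y \<Longrightarrow> epowr x a \<le> epowr y a"
  by (auto simp: epowr_def top_unique enn2real_mono less_top
      intro!: ennreal_leI powr_mono2)

text \<open>No sign condition on the exponents: \<open>epowr\<close> fixes \<open>0\<close> and
  \<open>top\<close> whatever the exponent, because \<open>0 powr a = 0\<close> for every
  \<open>a\<close>.\<close>

lemma epowr_epowr: "epowr (epowr x a) b = epowr x (a * b)"
  by (cases x) (simp_all add: epowr_ennreal powr_powr)

lemma epowr_one [simp]: "epowr x 1 = x"
  by (cases x) (simp_all add: epowr_ennreal)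

lemma epowr_eq_0_iff: "epowr x a = 0 \<longleftrightarrow> x = 0"
  by (cases x) (simp_all add: epowr_ennreal ennreal_eq_0_iff)

lemma epowr_eq_top_iff: "epowr x a = top \<longleftrightarrow> x = top"
  by (cases x) (simp_all add: epowr_ennreal)

lemma epowr_mult: "epowr (x * y) a = epowr x a * epowr y a"
proof (cases "x = top \<or> y = top")
  case True
  then show ?thesis
    by (cases "x = 0 \<or> y = 0") (auto simp: epowr_eq_0_iff ennreal_mult_top ennreal_top_mult)
next
  case False
  then show ?thesis
    by (cases x; cases y)
      (simp_all add: epowr_ennreal powr_mult flip: ennreal_mult)
qed

text \<open>Split off one factor, c^p = c c^(p-1), and enlarge the remaining base to a + b, which is
  monotone because p - 1 >= 0.\<close>

lemma powr_add_le_add_powr: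
  fixes a b p :: real
  assumes "0 \<le> a" "0 \<le> b" "1 \<le> p"
  shows "a powr p + b powr p \<le> (a + b) powr p"
proof -
  have split: "c powr p = c * c powr (p - 1)" if "0 \<le> c" for c :: real
    using that powr_mult_base[of c "p - 1"] by simp
  have "a powr p + b powr p = a * a powr (p - 1) + b * b powr (p - 1)"
    using assms split by simp
  also have "\<dots> \<le> a * (a + b) powr (p - 1) + b * (a + b) powr (p - 1)"
    using assms by (intro add_mono mult_left_mono powr_mono2) auto
  also have "\<dots> = (a + b) powr p"
    using assms split[of "a + b"] by (simp add: distrib_right)
  finally show ?thesis .
qed

text \<open>Bound the sum by twice the maximum. This is the origin of the factor 2 in the final
  estimate.\<close>

lemma add_powr_le:
  fixes a b q :: real
  assumes "0 \<le> a" "0 \<le> b" "0 \<le> q"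
  shows "(a + b) powr q \<le> 2 powr q * (a powr q + b powr q)"
proof -
  have "(a + b) powr q \<le> (2 * max a b) powr q"
    using assms by (intro powr_mono2) auto
  also have "\<dots> = 2 powr q * max a b powr q"
    using assms by (simp add: powr_mult)
  also have "\<dots> \<le> 2 powr q * (a powr q + b powr q)"
    by (simp add: max_def)
  finally show ?thesis .
qed

lemma epowr_add_le_add_epowr:
  assumes "1 \<le> p"
  shows "epowr x p + epowr y p \<le> epowr (x + y) p"
  using assms
  by (cases x; cases y)
    (simp_all add: epowr_ennreal powr_add_le_add_powr flip: ennreal_plus)

text \<open>The exponents sit on the integrands as weights with sum 1, which is the form in which
  d^r is split later. The proof normalises both integrals and integrates the weighted Young
  inequality.\<close>

lemma nn_integral_Hoelder:
  fixes f g :: "'a \<Rightarrow> real"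
  assumes [measurable]: "f \<in> borel_measurable M" "g \<in> borel_measurable M"
    and nonneg: "\<And>x. 0 \<le> f x" "\<And>x. 0 \<le> g x"
    and st: "0 < s" "0 < t" "s + t = 1"
  shows "(\<integral>\<^sup>+ x. ennreal (f x powr s * g x powr t) \<partial>M)
    \<le> epowr (\<integral>\<^sup>+ x. ennreal (f x) \<partial>M) s * epowr (\<integral>\<^sup>+ x. ennreal (g x) \<partial>M) t"
    (is "?L \<le> epowr ?A s * epowr ?B t")
proof -
  consider "?A = 0 \<or> ?B = 0" | "?A \<noteq> 0" "?B \<noteq> 0" "?A = top \<or> ?B = top"
    | "?A \<noteq> 0" "?B \<noteq> 0" "?A \<noteq> top" "?B \<noteq> top"
    by blast
  then show ?thesis
  proof cases
    \<comment> \<open>A vanishing integral forces the integrand on the left to vanish almost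
      everywhere, in agreement with \<open>0 * top = 0\<close> on the right.\<close>
    case 1
    moreover have "ennreal (f x) = 0 \<longleftrightarrow> f x = 0" "ennreal (g x) = 0 \<longleftrightarrow> g x = 0" for x
      using nonneg[of x] by (auto simp: ennreal_eq_0_iff)
    ultimately have "(AE x in M. f x = 0) \<or> (AE x in M. g x = 0)"
      by (simp add: nn_integral_0_iff_AE)
    then have "AE x in M. ennreal (f x powr s * g x powr t) = 0"
      by auto
    then have "?L = 0"
      by (subst nn_integral_0_iff_AE) auto
    then show ?thesis
      by simp
  next
    case 2
    then show ?thesis
      by (auto simp: epowr_eq_0_iff ennreal_mult_top ennreal_top_mult)
  next
    case 3
    then obtain a b where ab: "?A = ennreal a" "?B = ennreal b" "0 < a" "0 < b"
      by (cases ?A; cases ?B) auto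
    \<comment> \<open>Young's inequality for \<open>f x / a\<close> and \<open>g x / b\<close>.
      Integrating the last factor gives \<open>s + t = 1\<close>, since \<open>a\<close> and
      \<open>b\<close> are the two integrals.\<close>
    have le: "f x powr s * g x powr t \<le> a powr s * b powr t * (s / a * f x + t / b * g x)" for x
    proof (cases "f x = 0 \<or> g x = 0")
      case True
      then show ?thesis
        using nonneg st ab by auto
    next
      case False
      then have "0 < f x" "0 < g x"
        using nonneg by (auto simp: less_le)
      then have "(f x / a) powr s * (g x / b) powr t \<le> s * (f x / a) + t * (g x / b)"
        using st ab by (intro Youngs_inequality_0) auto
      then have "a powr s * b powr t * ((f x / a) powr s * (g x / b) powr t)
          \<le> a powr s * b powr t * (s * (f x / a) + t * (g x / b))"
        by (intro mult_left_mono) auto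
      with ab \<open>0 < f x\<close> \<open>0 < g x\<close> show ?thesis
        by (simp add: powr_divide)
    qed
    have "?L \<le> (\<integral>\<^sup>+ x. ennreal (a powr s * b powr t) *
        (ennreal (s / a) * ennreal (f x) + ennreal (t / b) * ennreal (g x)) \<partial>M)"
      using le nonneg st ab
      by (intro nn_integral_mono)
        (simp flip: ennreal_mult ennreal_plus)
    also have "\<dots> = ennreal (a powr s * b powr t) * (ennreal (s / a) * ?A + ennreal (t / b) * ?B)"
      by (simp add: nn_integral_cmult nn_integral_add)
    also have "\<dots> = epowr ?A s * epowr ?B t"
      using ab st by (simp add: epowr_ennreal flip: ennreal_mult ennreal_plus)
    finally show ?thesis .
  qed
qed

subsection \<open>Partial marginals, supports and transport plans\<close>

text \<open>Restrict \<open>\<pi>\<close> to the preimage of \<open>U\<close> and push it forward: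
  the image measure is \<open>\<mu>\<close>, and the change of variables formula applies. The
  indicator discards the mass that the marginal condition leaves free.\<close>

lemma nn_integral_partial_marginal:
  assumes g: "g \<in> \<pi> \<rightarrow>\<^sub>M borel" and U [measurable]: "U \<in> sets borel"
    and sets: "sets \<mu> = sets (restrict_space borel U)"
    and marginal: "\<And>A. A \<in> sets \<mu> \<Longrightarrow> emeasure \<pi> (g -` A \<inter> space \<pi>) = emeasure \<mu> A"
    and f: "f \<in> borel_measurable borel"
  shows "(\<integral>\<^sup>+ z. f (g z) * indicator U (g z) \<partial>\<pi>) = (\<integral>\<^sup>+ x. f x \<partial>\<mu>)"
proof -
  define V where "V = g -` U \<inter> space \<pi>"
  have V: "V \<in> sets \<pi>" "V \<inter> space \<pi> = V"
    using measurable_sets[OF g U] by (auto simp: V_def)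
  have g': "g \<in> restrict_space \<pi> V \<rightarrow>\<^sub>M restrict_space borel U"
    using g by (intro measurable_restrict_space2 measurable_restrict_space1)
      (auto simp: V_def space_restrict_space)
  have f': "f \<in> borel_measurable (restrict_space borel U)"
    using f by (rule measurable_restrict_space1)
  have "distr (restrict_space \<pi> V) (restrict_space borel U) g = \<mu>"
  proof (rule measure_eqI)
    show "sets (distr (restrict_space \<pi> V) (restrict_space borel U) g) = sets \<mu>"
      using sets by simp
    fix A assume "A \<in> sets (distr (restrict_space \<pi> V) (restrict_space borel U) g)"
    then have A: "A \<in> sets (restrict_space borel U)"
      by simp
    then have "A \<subseteq> U"
      by (auto simp: sets_restrict_space)
    then have "g -` A \<inter> space (restrict_space \<pi> V) = g -` A \<inter> space \<pi>"
      by (auto simp: V_def space_restrict_space)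
    moreover have "g -` A \<inter> space \<pi> \<subseteq> V"
      using \<open>A \<subseteq> U\<close> by (auto simp: V_def)
    ultimately show "emeasure (distr (restrict_space \<pi> V) (restrict_space borel U) g) A = emeasure \<mu> A"
      using A V g' marginal[of A] sets by (simp add: emeasure_distr emeasure_restrict_space)
  qed
  moreover have "(\<integral>\<^sup>+ x. f x \<partial>distr (restrict_space \<pi> V) (restrict_space borel U) g)
      = (\<integral>\<^sup>+ z. f (g z) \<partial>restrict_space \<pi> V)"
    using g' f' by (intro nn_integral_distr) auto
  ultimately have "(\<integral>\<^sup>+ x. f x \<partial>\<mu>) = (\<integral>\<^sup>+ z. f (g z) \<partial>restrict_space \<pi> V)"
    by (simp only:)
  also have "\<dots> = (\<integral>\<^sup>+ z. f (g z) * indicator V z \<partial>\<pi>)"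
    using V by (simp add: nn_integral_restrict_space)
  also have "\<dots> = (\<integral>\<^sup>+ z. f (g z) * indicator U (g z) \<partial>\<pi>)"
    by (intro nn_integral_cong) (auto simp: V_def indicator_def)
  finally show ?thesis ..
qed

text \<open>The complement of the support is covered by open null sets, and a countable basis
  reduces them to countably many. This turns the supremum over the support in the case of exponent
  \<open>\<infinity>\<close> into an almost-everywhere bound.\<close>

lemma AE_measure_support:
  fixes M :: "'a::second_countable_topology measure"
  assumes "sets M = sets (restrict_space borel S)"
  shows "AE z in M. z \<in> measure_support M"
proof -
  obtain \<B> :: "'a set set" where \<B>: "countable \<B>" "topological_basis \<B>"
    using ex_countable_basis by blast
  have meas: "U \<inter> space M \<in> sets M" if "open U" for U
  proof -
    have "space M = S"
      using sets_eq_imp_space_eq[OF assms] by (simp add: space_restrict_space)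
    moreover have "S \<inter> U \<in> sets (restrict_space borel S)"
      unfolding sets_restrict_space using that by (intro imageI borel_open)
    ultimately show ?thesis
      by (simp only: assms Int_commute)
  qed
  have "AE z in M. \<forall>U\<in>{U \<in> \<B>. emeasure M (U \<inter> space M) = 0}. z \<notin> U"
  proof (subst AE_ball_countable)
    show "countable {U \<in> \<B>. emeasure M (U \<inter> space M) = 0}"
      using \<B>(1) by simp
    show "\<forall>U\<in>{U \<in> \<B>. emeasure M (U \<inter> space M) = 0}. AE z in M. z \<notin> U"
    proof safe
      fix U assume "U \<in> \<B>" "emeasure M (U \<inter> space M) = 0"
      then show "AE z in M. z \<notin> U"
        using meas[of U] topological_basis_open[OF \<B>(2)]
        by (intro AE_I[of _ _ "U \<inter> space M"]) auto
    qed
  qed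
  then show ?thesis
  proof (rule AE_mp, intro AE_I2 impI)
    fix z assume z: "z \<in> space M"
      and avoid: "\<forall>U\<in>{U \<in> \<B>. emeasure M (U \<inter> space M) = 0}. z \<notin> U"
    have "emeasure M (U \<inter> space M) > 0" if "open U" "z \<in> U" for U
    proof -
      obtain V where V: "V \<in> \<B>" "z \<in> V" "V \<subseteq> U"
        using topological_basisE[OF \<B>(2) \<open>open U\<close> \<open>z \<in> U\<close>] .
      with avoid have "emeasure M (V \<inter> space M) \<noteq> 0"
        by blast
      then have "0 < emeasure M (V \<inter> space M)"
        by (rule zero_less_iff_neq_zero[THEN iffD2])
      also have "\<dots> \<le> emeasure M (U \<inter> space M)"
        using V meas[OF \<open>open U\<close>] by (intro emeasure_mono) auto
      finally show ?thesis .
    qed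
    with z show "z \<in> measure_support M"
      unfolding measure_support_def by blast
  qed
qed

section \<open>Geometry of the half-plane in the sup metric\<close>

definition diag_dist :: "point \<Rightarrow> real" where
  "diag_dist z = \<bar>snd z - fst z\<bar> / 2"

text \<open>In the sup metric the midpoint is a nearest diagonal point, at distance
  \<open>diag_dist z\<close>. The closed formula makes the projection continuous, hence
  measurable.\<close>

definition diag_proj :: "point \<Rightarrow> point" where
  "diag_proj z = ((fst z + snd z) / 2, (fst z + snd z) / 2)"

lemma upper_iff: "z \<in> upper \<longleftrightarrow> fst z < snd z"
  by (auto simp: upper_def)

lemma diagonal_iff: "z \<in> diagonal \<longleftrightarrow> fst z = snd z"
  by (cases z) (auto simp: diagonal_def)

lemma upper_closed_iff: "z \<in> upper_closed \<longleftrightarrow> fst z \<le> snd z"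
  by (auto simp: upper_closed_def upper_iff diagonal_iff)

lemma upper_borel [measurable]: "upper \<in> sets borel"
proof -
  have "open {z :: point. fst z < snd z}"
    by (intro open_Collect_less continuous_intros)
  moreover have "upper = {z. fst z < snd z}"
    by (auto simp: upper_iff)
  ultimately show ?thesis
    by simp
qed

lemma upper_closed_borel [measurable]: "upper_closed \<in> sets borel"
proof -
  have "closed {z :: point. fst z \<le> snd z}"
    by (intro closed_Collect_le continuous_intros)
  moreover have "upper_closed = {z. fst z \<le> snd z}"
    by (auto simp: upper_closed_iff)
  ultimately show ?thesis
    by simp
qed

lemma dist_sup_nonneg: "0 \<le> dist_sup z w"
  by (simp add: dist_sup_def le_max_iff_disj)

lemma diag_dist_nonneg: "0 \<le> diag_dist z"
  by (simp add: diag_dist_def)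

lemma diag_dist_eq_0: "z \<in> diagonal \<Longrightarrow> diag_dist z = 0"
  by (simp add: diag_dist_def diagonal_iff)

lemma diag_proj_in: "diag_proj z \<in> diagonal" "diag_proj z \<in> upper_closed" "diag_proj z \<notin> upper"
  by (simp_all add: diag_proj_def diagonal_iff upper_closed_iff upper_iff)

lemma dist_sup_diag_proj:
  "dist_sup z (diag_proj z) = diag_dist z" "dist_sup (diag_proj z) z = diag_dist z"
  by (simp_all add: dist_sup_def diag_proj_def diag_dist_def max_def abs_if field_simps)

lemma diag_dist_le_dist_sup: "w \<in> diagonal \<Longrightarrow> diag_dist z \<le> dist_sup z w"
  unfolding dist_sup_def diag_dist_def diagonal_iff by (simp add: max_def abs_if)

lemma dist_sup_measurable [measurable]:
  "(\<lambda>z. dist_sup (fst z) (snd z)) \<in> borel_measurable borel"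
  unfolding dist_sup_def by (intro borel_measurable_continuous_onI continuous_intros)

lemma diag_dist_measurable [measurable]: "diag_dist \<in> borel_measurable borel"
  unfolding diag_dist_def by (intro borel_measurable_continuous_onI continuous_intros) simp

lemma borel_fst_measurable: "(fst :: point \<times> point \<Rightarrow> point) \<in> borel \<rightarrow>\<^sub>M borel"
  and borel_snd_measurable: "(snd :: point \<times> point \<Rightarrow> point) \<in> borel \<rightarrow>\<^sub>M borel"
  by (intro borel_measurable_continuous_onI continuous_intros)+

section \<open>Transport plans and their partial marginals\<close>

abbreviation plan_space :: "(point \<times> point) measure" where
  "plan_space \<equiv> restrict_space borel (upper_closed \<times> upper_closed)"

lemma space_plan_space [simp]: "space plan_space = upper_closed \<times> upper_closed"
  by (simp add: space_restrict_space)

lemma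
  assumes "\<pi> \<in> plans \<mu> \<nu>"
  shows plans_sets: "sets \<pi> = sets plan_space"
    and plans_space: "space \<pi> = upper_closed \<times> upper_closed"
  using assms sets_eq_imp_space_eq[of \<pi> plan_space] by (auto simp: plans_def)

lemma plans_measurable:
  assumes "\<pi> \<in> plans \<mu> \<nu>" and "f \<in> borel \<rightarrow>\<^sub>M N"
  shows "f \<in> \<pi> \<rightarrow>\<^sub>M N"
  using measurable_restrict_space1[OF assms(2)] plans_sets[OF assms(1)]
  by (simp cong: measurable_cong_sets)

lemma sets_restrict_upperD:
  assumes "A \<in> sets (restrict_space borel upper)"
  shows "A \<subseteq> upper" and "A \<subseteq> upper_closed" and "A \<in> sets borel"
  using assms by (auto simp: sets_restrict_space upper_closed_def)

lemma
  assumes "A \<in> sets (restrict_space borel upper)"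
  shows cylinder_fst: "A \<times> upper_closed \<in> sets plan_space"
    and cylinder_snd: "upper_closed \<times> A \<in> sets plan_space"
proof -
  have "A \<times> upper_closed \<in> sets borel" "upper_closed \<times> A \<in> sets borel"
    using pair_measureI[OF sets_restrict_upperD(3)[OF assms] upper_closed_borel]
      pair_measureI[OF upper_closed_borel sets_restrict_upperD(3)[OF assms]]
    by (simp_all only: borel_prod)
  then show "A \<times> upper_closed \<in> sets plan_space" "upper_closed \<times> A \<in> sets plan_space"
    using sets_restrict_upperD(2)[OF assms] by (auto simp: sets_restrict_space image_iff)
qed

lemma
  assumes \<pi>: "\<pi> \<in> plans \<mu> \<nu>" and f: "f \<in> borel_measurable borel"
  shows nn_integral_plan_fst: "sets \<mu> = sets (restrict_space borel upper) \<Longrightarrow>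
      (\<integral>\<^sup>+ z. f (fst z) * indicator upper (fst z) \<partial>\<pi>) = (\<integral>\<^sup>+ x. f x \<partial>\<mu>)"
    and nn_integral_plan_snd: "sets \<nu> = sets (restrict_space borel upper) \<Longrightarrow>
      (\<integral>\<^sup>+ z. f (snd z) * indicator upper (snd z) \<partial>\<pi>) = (\<integral>\<^sup>+ x. f x \<partial>\<nu>)"
proof -
  show "(\<integral>\<^sup>+ z. f (fst z) * indicator upper (fst z) \<partial>\<pi>) = (\<integral>\<^sup>+ x. f x \<partial>\<mu>)"
    if sets: "sets \<mu> = sets (restrict_space borel upper)"
  proof (rule nn_integral_partial_marginal)
    show "fst \<in> \<pi> \<rightarrow>\<^sub>M borel"
      using \<pi> borel_fst_measurable by (rule plans_measurable)
    show "emeasure \<pi> (fst -` A \<inter> space \<pi>) = emeasure \<mu> A" if "A \<in> sets \<mu>" for A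
    proof -
      have "fst -` A \<inter> space \<pi> = A \<times> upper_closed"
        using sets_restrict_upperD(2) that sets plans_space[OF \<pi>] by auto
      then show ?thesis
        using that sets \<pi> by (auto simp: plans_def)
    qed
  qed (use sets f in auto)
  show "(\<integral>\<^sup>+ z. f (snd z) * indicator upper (snd z) \<partial>\<pi>) = (\<integral>\<^sup>+ x. f x \<partial>\<nu>)"
    if sets: "sets \<nu> = sets (restrict_space borel upper)"
  proof (rule nn_integral_partial_marginal)
    show "snd \<in> \<pi> \<rightarrow>\<^sub>M borel"
      using \<pi> borel_snd_measurable by (rule plans_measurable)
    show "emeasure \<pi> (snd -` A \<inter> space \<pi>) = emeasure \<nu> A" if "A \<in> sets \<nu>" for A
    proof -
      have "snd -` A \<inter> space \<pi> = upper_closed \<times> A"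
        using sets_restrict_upperD(2) that sets plans_space[OF \<pi>] by auto
      then show ?thesis
        using that sets \<pi> by (auto simp: plans_def)
    qed
  qed (use sets f in auto)
qed

text \<open>A property holds almost everywhere iff the indicator of its failure set has integral 0,
  so the integral identities for the marginals transfer null sets. Diagonal coordinates are exempt
  because the plan is unconstrained there.\<close>

lemma
  assumes \<pi>: "\<pi> \<in> plans \<mu> \<nu>" and [measurable]: "Measurable.pred borel P"
  shows AE_plan_fst: "sets \<mu> = sets (restrict_space borel upper) \<Longrightarrow>
      (AE z in \<pi>. fst z \<in> upper \<longrightarrow> P (fst z)) \<longleftrightarrow> (AE x in \<mu>. P x)"
    and AE_plan_snd: "sets \<nu> = sets (restrict_space borel upper) \<Longrightarrow>
      (AE z in \<pi>. snd z \<in> upper \<longrightarrow> P (snd z)) \<longleftrightarrow> (AE x in \<nu>. P x)"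
proof -
  let ?f = "indicator {x. \<not> P x} :: point \<Rightarrow> ennreal"
  let ?u = "indicator upper :: point \<Rightarrow> ennreal"
  have f: "?f \<in> borel_measurable borel"
    by measurable
  have fu: "(\<lambda>x. ?f x * ?u x) \<in> borel_measurable borel"
    by measurable
  have f': "?f \<in> borel_measurable M" if "sets M = sets (restrict_space borel upper)" for M
    using measurable_restrict_space1[OF f] that by (simp cong: measurable_cong_sets)
  have zero: "?f x * ?u x = 0 \<longleftrightarrow> x \<in> upper \<longrightarrow> P x" "?f x = 0 \<longleftrightarrow> P x" for x
    by (auto simp: indicator_def)
  show "(AE z in \<pi>. fst z \<in> upper \<longrightarrow> P (fst z)) \<longleftrightarrow> (AE x in \<mu>. P x)"
    if "sets \<mu> = sets (restrict_space borel upper)"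
  proof -
    have "(AE z in \<pi>. ?f (fst z) * ?u (fst z) = 0) \<longleftrightarrow> (AE x in \<mu>. ?f x = 0)"
      using nn_integral_plan_fst[OF \<pi> f that] f'[OF that]
        plans_measurable[OF \<pi> measurable_compose[OF borel_fst_measurable fu]]
      by (simp only: flip: nn_integral_0_iff_AE)
    then show ?thesis
      by (simp only: zero)
  qed
  show "(AE z in \<pi>. snd z \<in> upper \<longrightarrow> P (snd z)) \<longleftrightarrow> (AE x in \<nu>. P x)"
    if "sets \<nu> = sets (restrict_space borel upper)"
  proof -
    have "(AE z in \<pi>. ?f (snd z) * ?u (snd z) = 0) \<longleftrightarrow> (AE x in \<nu>. ?f x = 0)"
      using nn_integral_plan_snd[OF \<pi> f that] f'[OF that]
        plans_measurable[OF \<pi> measurable_compose[OF borel_snd_measurable fu]]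
      by (simp only: flip: nn_integral_0_iff_AE)
    then show ?thesis
      by (simp only: zero)
  qed
qed

lemma sets_empty_diagram: "sets empty_diagram = sets (restrict_space borel upper)"
  by (simp add: empty_diagram_def)

text \<open>The second marginal has no mass on \<open>upper\<close>, and the rest of
  \<open>upper_closed\<close> is the diagonal.\<close>

lemma AE_plan_empty_diagram:
  assumes "\<pi> \<in> plans \<mu> empty_diagram"
  shows "AE z in \<pi>. snd z \<in> diagonal"
proof -
  have U: "upper \<in> sets (restrict_space borel upper)"
    using upper_borel by (auto simp: sets_restrict_space)
  have "emeasure \<pi> (upper_closed \<times> upper) = 0"
    using assms U by (auto simp: plans_def empty_diagram_def)
  then show ?thesis
    using cylinder_snd[OF U] plans_sets[OF assms] plans_space[OF assms]
    by (intro AE_I[of _ _ "upper_closed \<times> upper"]) (auto simp: upper_closed_def)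
qed

section \<open>Transport costs and lower bounds for the persistence\<close>

definition cost :: "real \<Rightarrow> (point \<times> point) measure \<Rightarrow> ennreal" where
  "cost p \<pi> = (\<integral>\<^sup>+ z. ennreal (dist_sup (fst z) (snd z) powr p) \<partial>\<pi>)"

lemma pdist_eq_cost:
  "p \<noteq> \<infinity> \<Longrightarrow> pdist p \<mu> \<nu> = epowr (INF \<pi> \<in> plans \<mu> \<nu>. cost (enn2real p) \<pi>) (1 / enn2real p)"
  by (simp add: pdist_def cost_def case_prod_beta')

text \<open>A plan to the empty diagram ends on the diagonal, so it moves almost every point at
  least by its distance to the diagonal.\<close>

lemma nn_integral_diag_dist_le_Pers:
  assumes sets: "sets \<mu> = sets (restrict_space borel upper)" and q: "0 < q" "q \<noteq> \<infinity>"
  shows "(\<integral>\<^sup>+ z. ennreal (diag_dist z powr enn2real q) \<partial>\<mu>) \<le> epowr (Pers q \<mu>) (enn2real q)"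
proof -
  let ?q = "enn2real q"
  have "0 < ?q"
    using q by (simp add: enn2real_positive_iff less_top)
  have "(\<integral>\<^sup>+ z. ennreal (diag_dist z powr ?q) \<partial>\<mu>) \<le> (INF \<pi> \<in> plans \<mu> empty_diagram. cost ?q \<pi>)"
  proof (rule INF_greatest)
    fix \<pi> assume \<pi>: "\<pi> \<in> plans \<mu> empty_diagram"
    have "(\<integral>\<^sup>+ z. ennreal (diag_dist z powr ?q) \<partial>\<mu>)
        = (\<integral>\<^sup>+ z. ennreal (diag_dist (fst z) powr ?q) * indicator upper (fst z) \<partial>\<pi>)"
      using \<pi> sets by (intro nn_integral_plan_fst[symmetric]) auto
    also have "\<dots> \<le> cost ?q \<pi>"
      unfolding cost_def using AE_plan_empty_diagram[OF \<pi>]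
    proof (intro nn_integral_mono_AE, eventually_elim)
      case (elim z)
      then show ?case
        using \<open>0 < ?q\<close> diag_dist_le_dist_sup[of "snd z" "fst z"]
        by (auto simp: indicator_def diag_dist_nonneg intro!: ennreal_leI powr_mono2)
    qed
    finally show "(\<integral>\<^sup>+ z. ennreal (diag_dist z powr ?q) \<partial>\<mu>) \<le> cost ?q \<pi>" .
  qed
  also have "\<dots> = epowr (Pers q \<mu>) ?q"
    using q \<open>0 < ?q\<close> by (simp add: Pers_def pdist_eq_cost epowr_epowr)
  finally show ?thesis .
qed

text \<open>Counterpart for exponent \<open>\<infinity>\<close> of the preceding bound: for a fixed
  plan, almost every pair lies in the support and ends on the diagonal.\<close>

lemma AE_diag_dist_le_Pers_infinity:
  assumes sets: "sets \<mu> = sets (restrict_space borel upper)"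
  shows "AE z in \<mu>. ennreal (diag_dist z) \<le> Pers \<infinity> \<mu>"
proof -
  define S where "S \<sigma> = (SUP z \<in> measure_support \<sigma>. ennreal (dist_sup (fst z) (snd z)))" for \<sigma>
  have Pers: "Pers \<infinity> \<mu> = (INF \<sigma> \<in> plans \<mu> empty_diagram. S \<sigma>)"
    by (simp add: Pers_def pdist_def S_def case_prod_beta')
  have bound: "AE z in \<mu>. ennreal (diag_dist z) \<le> S \<sigma>" if \<sigma>: "\<sigma> \<in> plans \<mu> empty_diagram" for \<sigma>
  proof -
    have "AE z in \<sigma>. fst z \<in> upper \<longrightarrow> ennreal (diag_dist (fst z)) \<le> S \<sigma>"
      using AE_plan_empty_diagram[OF \<sigma>] AE_measure_support[OF plans_sets[OF \<sigma>]]
    proof eventually_elim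
      case (elim z)
      have "ennreal (diag_dist (fst z)) \<le> ennreal (dist_sup (fst z) (snd z))"
        using elim by (intro ennreal_leI diag_dist_le_dist_sup)
      also have "\<dots> \<le> S \<sigma>"
        unfolding S_def using elim by (intro SUP_upper)
      finally show ?case
        by simp
    qed
    then show ?thesis
      by (subst (asm) AE_plan_fst[OF \<sigma> _ sets]) auto
  qed
  show ?thesis
  proof (cases "plans \<mu> empty_diagram = {}")
    case False
    \<comment> \<open>The exceptional null set depends on the plan. Writing the infimum over a
      sequence of plans leaves countably many null sets. If there were no plans, the infimum would
      be \<open>top\<close>.\<close>
    then obtain f :: "nat \<Rightarrow> ennreal"
      where f: "range f \<subseteq> S ` plans \<mu> empty_diagram" "Pers \<infinity> \<mu> = (INF n. f n)"
      unfolding Pers using ennreal_Inf_countable_INF[of "S ` plans \<mu> empty_diagram"] by (metis image_is_empty)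
    have "AE z in \<mu>. ennreal (diag_dist z) \<le> f n" for n
    proof -
      obtain \<sigma> where "\<sigma> \<in> plans \<mu> empty_diagram" "f n = S \<sigma>"
        using f(1) by blast
      with bound show ?thesis
        by simp
    qed
    then have "AE z in \<mu>. \<forall>n. ennreal (diag_dist z) \<le> f n"
      by (simp add: AE_all_countable)
    then show ?thesis
      by (simp only: f(2) le_INF_iff) simp
  qed (simp only: Pers, simp)
qed

subsection \<open>Shortening transport plans\<close>

lemma fst_proj_measurable: "(\<lambda>z. (fst z, diag_proj (fst z))) \<in> plan_space \<rightarrow>\<^sub>M plan_space"
  and snd_proj_measurable: "(\<lambda>z. (diag_proj (snd z), snd z)) \<in> plan_space \<rightarrow>\<^sub>M plan_space"
proof -
  have "(\<lambda>z. (fst z, diag_proj (fst z))) \<in> borel_measurable (borel :: (point \<times> point) measure)"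
    "(\<lambda>z. (diag_proj (snd z), snd z)) \<in> borel_measurable (borel :: (point \<times> point) measure)"
    unfolding diag_proj_def
    by (intro borel_measurable_continuous_onI continuous_intros; simp)+
  then show "(\<lambda>z. (fst z, diag_proj (fst z))) \<in> plan_space \<rightarrow>\<^sub>M plan_space"
    "(\<lambda>z. (diag_proj (snd z), snd z)) \<in> plan_space \<rightarrow>\<^sub>M plan_space"
    by (auto intro!: measurable_restrict_space3 simp: diag_proj_in)
qed

text \<open>Witness: send all of \<open>\<mu>\<close> to the diagonal and create all of
  \<open>\<nu>\<close> from it. Infima over plans are thereby taken over a nonempty set.\<close>

lemma plans_nonempty:
  assumes sets: "sets \<mu> = sets (restrict_space borel upper)"
    "sets \<nu> = sets (restrict_space borel upper)"
  shows "plans \<mu> \<nu> \<noteq> {}"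
proof -
  have space: "space \<mu> = upper" "space \<nu> = upper"
    using sets[THEN sets_eq_imp_space_eq] by (simp_all add: space_restrict_space)
  have "(\<lambda>x. (x, diag_proj x)) \<in> borel \<rightarrow>\<^sub>M borel" "(\<lambda>x. (diag_proj x, x)) \<in> borel \<rightarrow>\<^sub>M borel"
    unfolding diag_proj_def
    by (intro borel_measurable_continuous_onI continuous_intros; simp)+
  then have "(\<lambda>x. (x, diag_proj x)) \<in> restrict_space borel upper \<rightarrow>\<^sub>M plan_space"
    "(\<lambda>x. (diag_proj x, x)) \<in> restrict_space borel upper \<rightarrow>\<^sub>M plan_space"
    using diag_proj_in by (auto intro!: measurable_restrict_space3 simp: upper_closed_def)
  then have meas: "(\<lambda>x. (x, diag_proj x)) \<in> \<mu> \<rightarrow>\<^sub>M plan_space" "(\<lambda>x. (diag_proj x, x)) \<in> \<nu> \<rightarrow>\<^sub>M plan_space"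
    using sets by (simp_all cong: measurable_cong_sets)
  let ?\<pi>1 = "distr \<mu> plan_space (\<lambda>x. (x, diag_proj x))"
  let ?\<pi>2 = "distr \<nu> plan_space (\<lambda>x. (diag_proj x, x))"
  have "measure_sum ?\<pi>1 ?\<pi>2 \<in> plans \<mu> \<nu>"
    unfolding plans_def
  proof (intro CollectI conjI ballI)
    fix A assume A: "A \<in> sets (restrict_space borel upper)"
    note AD = sets_restrict_upperD[OF A] and cyl = cylinder_fst[OF A] cylinder_snd[OF A]
    \<comment> \<open>Projected points lie outside \<open>upper\<close>, so each marginal sees only
      one of the two pieces.\<close>
    have notin: "diag_proj x \<notin> A" for x
      using AD diag_proj_in by blast
    have "(\<lambda>x. (x, diag_proj x)) -` (A \<times> upper_closed) \<inter> space \<mu> = A"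
      "(\<lambda>x. (diag_proj x, x)) -` (A \<times> upper_closed) \<inter> space \<nu> = {}"
      using AD notin diag_proj_in(2) unfolding space vimage_def mem_Sigma_iff by blast+
    then show "emeasure (measure_sum ?\<pi>1 ?\<pi>2) (A \<times> upper_closed) = emeasure \<mu> A"
      using cyl meas by (simp add: emeasure_measure_sum emeasure_distr)
    have "(\<lambda>x. (x, diag_proj x)) -` (upper_closed \<times> A) \<inter> space \<mu> = {}"
      "(\<lambda>x. (diag_proj x, x)) -` (upper_closed \<times> A) \<inter> space \<nu> = A"
      using AD notin diag_proj_in(2) unfolding space vimage_def mem_Sigma_iff by blast+
    then show "emeasure (measure_sum ?\<pi>1 ?\<pi>2) (upper_closed \<times> A) = emeasure \<nu> A"
      using cyl meas by (simp add: emeasure_measure_sum emeasure_distr)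
  qed simp
  then show ?thesis
    by blast
qed

text \<open>Mass that travels further than a detour through the diagonal is sent to the diagonal at both
  ends instead; this does not increase the cost, because \<open>a powr p + b powr p \<le> (a + b) powr p\<close>.\<close>

lemma plan_short_transport:
  assumes \<pi>: "\<pi> \<in> plans \<mu> \<nu>" and p: "1 \<le> p"
  obtains \<pi>' where "\<pi>' \<in> plans \<mu> \<nu>" "cost p \<pi>' \<le> cost p \<pi>"
    "AE z in \<pi>'. dist_sup (fst z) (snd z) \<le> diag_dist (fst z) + diag_dist (snd z)"
proof -
  define G where "G = {z. dist_sup (fst z) (snd z) \<le> diag_dist (fst z) + diag_dist (snd z)}"
  define f1 f2 :: "point \<times> point \<Rightarrow> point \<times> point"
    where "f1 = (\<lambda>z. (fst z, diag_proj (fst z)))" and "f2 = (\<lambda>z. (diag_proj (snd z), snd z))"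
  note [measurable_cong] = plans_sets[OF \<pi>]
  have dd: "(\<lambda>z :: point \<times> point. diag_dist (fst z)) \<in> borel_measurable borel"
    "(\<lambda>z :: point \<times> point. diag_dist (snd z)) \<in> borel_measurable borel"
    by (intro measurable_compose[OF borel_fst_measurable diag_dist_measurable]
        measurable_compose[OF borel_snd_measurable diag_dist_measurable])+
  have G_borel: "G \<in> sets borel"
    using dist_sup_measurable dd unfolding G_def by measurable
  have [measurable]: "f1 \<in> plan_space \<rightarrow>\<^sub>M plan_space" "f2 \<in> plan_space \<rightarrow>\<^sub>M plan_space"
    unfolding f1_def f2_def by (rule fst_proj_measurable snd_proj_measurable)+
  have indicators [measurable]: "(indicator G :: _ \<Rightarrow> ennreal) \<in> borel_measurable plan_space"
    "(indicator (- G) :: _ \<Rightarrow> ennreal) \<in> borel_measurable plan_space"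
    using G_borel by (auto intro!: measurable_restrict_space1)
  \<comment> \<open>Outside \<open>G\<close> each pair (x, y) is replaced by the two pairs (x,
    \<open>diag_proj x\<close>) and (\<open>diag_proj y\<close>, y).\<close>
  define \<pi>' where "\<pi>' = measure_sum (density \<pi> (indicator G))
    (measure_sum (distr (density \<pi> (indicator (- G))) plan_space f1)
      (distr (density \<pi> (indicator (- G))) plan_space f2))"
  have sets': "sets \<pi>' = sets plan_space"
    using plans_sets[OF \<pi>] by (simp add: \<pi>'_def)
  \<comment> \<open>Marginals, cost and the almost-everywhere bound for \<open>\<pi>'\<close> all
    follow from this formula by a choice of \<open>f\<close>.\<close>
  have integral: "(\<integral>\<^sup>+ z. f z \<partial>\<pi>') = (\<integral>\<^sup>+ z. (if z \<in> G then f z else f (f1 z) + f (f2 z)) \<partial>\<pi>)"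
    if [measurable]: "f \<in> borel_measurable plan_space" for f
  proof -
    have "(\<integral>\<^sup>+ z. f z \<partial>\<pi>') = (\<integral>\<^sup>+ z. indicator G z * f z \<partial>\<pi>)
        + ((\<integral>\<^sup>+ z. indicator (- G) z * f (f1 z) \<partial>\<pi>) + (\<integral>\<^sup>+ z. indicator (- G) z * f (f2 z) \<partial>\<pi>))"
      unfolding \<pi>'_def using plans_sets[OF \<pi>]
      by (simp add: nn_integral_measure_sum nn_integral_distr nn_integral_density)
    also have "\<dots> = (\<integral>\<^sup>+ z. indicator G z * f z
        + (indicator (- G) z * f (f1 z) + indicator (- G) z * f (f2 z)) \<partial>\<pi>)"
      by (simp add: nn_integral_add)
    also have "\<dots> = (\<integral>\<^sup>+ z. (if z \<in> G then f z else f (f1 z) + f (f2 z)) \<partial>\<pi>)"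
      by (intro nn_integral_cong) (simp add: indicator_def)
    finally show ?thesis .
  qed
  show thesis
  proof
    show "\<pi>' \<in> plans \<mu> \<nu>"
      unfolding plans_def
    proof (intro CollectI conjI ballI)
      fix A assume A: "A \<in> sets (restrict_space borel upper)"
      note AD = sets_restrict_upperD[OF A] and cyl = cylinder_fst[OF A] cylinder_snd[OF A]
      \<comment> \<open>For a cylinder over \<open>A\<close> inside \<open>upper\<close>, one of the
        two new pairs misses \<open>E\<close> and the other lies in \<open>E\<close> exactly when
        \<open>z\<close> does, so rerouting preserves its mass.\<close>
      have invariant: "emeasure \<pi>' E = emeasure \<pi> E" if E: "E \<in> sets plan_space"
        and eq: "\<And>z. z \<in> upper_closed \<times> upper_closed \<Longrightarrow>
          indicator E (f1 z) + indicator E (f2 z) = (indicator E z :: ennreal)" for E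
      proof -
        have "emeasure \<pi>' E = (\<integral>\<^sup>+ z. indicator E z \<partial>\<pi>')"
          using E sets' by simp
        also have "\<dots> = (\<integral>\<^sup>+ z. (if z \<in> G then indicator E z
            else indicator E (f1 z) + indicator E (f2 z)) \<partial>\<pi>)"
          using E by (intro integral) auto
        also have "\<dots> = (\<integral>\<^sup>+ z. indicator E z \<partial>\<pi>)"
          by (intro nn_integral_cong) (simp only: eq plans_space[OF \<pi>] if_cancel)
        also have "\<dots> = emeasure \<pi> E"
          using E plans_sets[OF \<pi>] by simp
        finally show ?thesis .
      qed
      have "emeasure \<pi>' (A \<times> upper_closed) = emeasure \<pi> (A \<times> upper_closed)"
        using AD diag_proj_in
        by (intro invariant cyl) (auto simp: f1_def f2_def indicator_def)
      then show "emeasure \<pi>' (A \<times> upper_closed) = emeasure \<mu> A"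
        using \<pi> A by (simp add: plans_def)
      have "emeasure \<pi>' (upper_closed \<times> A) = emeasure \<pi> (upper_closed \<times> A)"
        using AD diag_proj_in
        by (intro invariant cyl) (auto simp: f1_def f2_def indicator_def)
      then show "emeasure \<pi>' (upper_closed \<times> A) = emeasure \<nu> A"
        using \<pi> A by (simp add: plans_def)
    qed (fact sets')
    have cost_meas: "(\<lambda>z. ennreal (dist_sup (fst z) (snd z) powr p)) \<in> borel_measurable plan_space"
      using measurable_restrict_space1[OF dist_sup_measurable] by measurable
    show "cost p \<pi>' \<le> cost p \<pi>"
      unfolding cost_def integral[OF cost_meas]
    proof (intro nn_integral_mono)
      fix z assume "z \<in> space \<pi>"
      show "(if z \<in> G then ennreal (dist_sup (fst z) (snd z) powr p)
          else ennreal (dist_sup (fst (f1 z)) (snd (f1 z)) powr p)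
            + ennreal (dist_sup (fst (f2 z)) (snd (f2 z)) powr p))
        \<le> ennreal (dist_sup (fst z) (snd z) powr p)"
      proof (cases "z \<in> G")
        case False
        have "diag_dist (fst z) powr p + diag_dist (snd z) powr p
            \<le> (diag_dist (fst z) + diag_dist (snd z)) powr p"
          using p by (intro powr_add_le_add_powr diag_dist_nonneg)
        also have "\<dots> \<le> dist_sup (fst z) (snd z) powr p"
          using False p by (intro powr_mono2) (auto simp: G_def diag_dist_nonneg)
        finally show ?thesis
          using False by (simp add: f1_def f2_def dist_sup_diag_proj flip: ennreal_plus)
      qed simp
    qed
    \<comment> \<open>A rerouted pair travels exactly the distance of one endpoint to the diagonal,
      so no mass of \<open>\<pi>'\<close> is left outside \<open>G\<close>.\<close>
    have "f1 z \<in> G" "f2 z \<in> G" for z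
      by (simp_all add: G_def f1_def f2_def dist_sup_diag_proj diag_dist_nonneg)
    then have "(\<integral>\<^sup>+ z. indicator (- G) z \<partial>\<pi>') = (\<integral>\<^sup>+ z. 0 \<partial>\<pi>)"
      unfolding integral[OF indicators(2)] by (intro nn_integral_cong) simp
    moreover have "(indicator (- G) :: _ \<Rightarrow> ennreal) \<in> borel_measurable \<pi>'"
      using indicators sets' by (simp cong: measurable_cong_sets)
    ultimately have "AE z in \<pi>'. indicator (- G) z = (0 :: ennreal)"
      by (simp add: nn_integral_0_iff_AE)
    then show "AE z in \<pi>'. dist_sup (fst z) (snd z) \<le> diag_dist (fst z) + diag_dist (snd z)"
      by eventually_elim (simp add: indicator_def G_def split: if_splits)
  qed
qed

text \<open>Here \<open>1 / enn2real \<infinity> = 0\<close>, so the conjugacy hypothesis also covers \<open>q = \<infinity>\<close>.\<close>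

lemma cost_interpolation:
  fixes p r \<theta> :: real and q :: ennreal
  assumes sets: "sets \<mu> = sets (restrict_space borel upper)"
      "sets \<nu> = sets (restrict_space borel upper)"
    and fin: "Pers q \<mu> < \<infinity>" "Pers q \<nu> < \<infinity>"
    and p: "1 \<le> p" and q: "1 \<le> q" and r: "0 < r" and \<theta>: "0 < \<theta>" "\<theta> < 1"
    and conj: "1 / r = \<theta> / p + (1 - \<theta>) / enn2real q"
    and \<pi>: "\<pi> \<in> plans \<mu> \<nu>"
  obtains \<pi>' where "\<pi>' \<in> plans \<mu> \<nu>"
    "cost r \<pi>' \<le> epowr (cost p \<pi>) (r * \<theta> / p)
      * epowr (2 * (Pers q \<mu> + Pers q \<nu>)) (r * (1 - \<theta>))"
proof -
  obtain \<pi>' where \<pi>': "\<pi>' \<in> plans \<mu> \<nu>" and le: "cost p \<pi>' \<le> cost p \<pi>"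
    and short: "AE z in \<pi>'. dist_sup (fst z) (snd z) \<le> diag_dist (fst z) + diag_dist (snd z)"
    using plan_short_transport[OF \<pi> p] .
  note meas = plans_measurable[OF \<pi>']
  have [measurable]: "(\<lambda>z. dist_sup (fst z) (snd z)) \<in> borel_measurable \<pi>'"
    "(\<lambda>z. diag_dist (fst z)) \<in> borel_measurable \<pi>'" "(\<lambda>z. diag_dist (snd z)) \<in> borel_measurable \<pi>'"
    using meas[OF dist_sup_measurable] meas[OF borel_fst_measurable] meas[OF borel_snd_measurable]
    by (auto intro: measurable_compose[OF _ diag_dist_measurable])
  let ?d = "\<lambda>z. dist_sup (fst z) (snd z)"
  let ?B = "2 * (Pers q \<mu> + Pers q \<nu>)"
  have s_pos: "0 < r * \<theta> / p"
    using p r \<theta> by simp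
  have "cost r \<pi>' \<le> epowr (cost p \<pi>') (r * \<theta> / p) * epowr ?B (r * (1 - \<theta>))"
  proof (cases "q = \<infinity>")
    case False
    define q' where "q' = enn2real q"
    have q'1: "1 \<le> q'"
      using q False enn2real_mono[of 1 q] by (simp add: q'_def less_top)
    then have q': "0 < q'"
      by simp
    \<comment> \<open>Hoelder weights: \<open>conj\<close> multiplied by \<open>r\<close> is
      \<open>?s + ?t = 1\<close>.\<close>
    let ?s = "r * \<theta> / p" and ?t = "r * (1 - \<theta>) / q'"
    have t_pos: "0 < ?t"
      using q' r \<theta> by simp
    have st: "?s + ?t = 1"
      using conj r by (simp add: q'_def field_simps)
    have exps: "p * ?s + q' * ?t = r"
      using p q' by (simp add: field_simps)
    have "cost r \<pi>' = (\<integral>\<^sup>+ z. ennreal ((?d z powr p) powr ?s * (?d z powr q') powr ?t) \<partial>\<pi>')"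
      unfolding cost_def
    proof (intro nn_integral_cong)
      fix z
      have "(?d z powr p) powr ?s * (?d z powr q') powr ?t = ?d z powr (p * ?s + q' * ?t)"
        by (simp only: powr_powr powr_add)
      then show "ennreal (?d z powr r) = ennreal ((?d z powr p) powr ?s * (?d z powr q') powr ?t)"
        by (simp only: exps)
    qed
    also have "\<dots> \<le> epowr (cost p \<pi>') ?s * epowr (cost q' \<pi>') ?t"
      unfolding cost_def using s_pos t_pos st by (intro nn_integral_Hoelder) auto
    also have "cost q' \<pi>' \<le> epowr ?B q'"
    proof -
      have "cost q' \<pi>' \<le> (\<integral>\<^sup>+ z. ennreal (2 powr q') *
          (ennreal (diag_dist (fst z) powr q') + ennreal (diag_dist (snd z) powr q')) \<partial>\<pi>')"
        unfolding cost_def using short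
      proof (intro nn_integral_mono_AE, eventually_elim)
        case (elim z)
        then have "?d z powr q' \<le> (diag_dist (fst z) + diag_dist (snd z)) powr q'"
          using q' by (intro powr_mono2) (auto simp: dist_sup_nonneg)
        also have "\<dots> \<le> 2 powr q' * (diag_dist (fst z) powr q' + diag_dist (snd z) powr q')"
          using q' by (intro add_powr_le diag_dist_nonneg) auto
        finally show ?case
          by (simp add: ennreal_leI flip: ennreal_plus ennreal_mult)
      qed
      also have "\<dots> = ennreal (2 powr q') * ((\<integral>\<^sup>+ z. ennreal (diag_dist (fst z) powr q') \<partial>\<pi>')
          + (\<integral>\<^sup>+ z. ennreal (diag_dist (snd z) powr q') \<partial>\<pi>'))"
        by (simp add: nn_integral_cmult nn_integral_add)
      \<comment> \<open>The indicator may be inserted because \<open>diag_dist\<close> vanishes on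
        the diagonal; only then do the marginals apply.\<close>
      also have "(\<integral>\<^sup>+ z. ennreal (diag_dist (fst z) powr q') \<partial>\<pi>')
          = (\<integral>\<^sup>+ z. ennreal (diag_dist (fst z) powr q') * indicator upper (fst z) \<partial>\<pi>')"
        using plans_space[OF \<pi>'] by (intro nn_integral_cong)
          (auto simp: upper_closed_def diag_dist_eq_0 indicator_def)
      also have "\<dots> = (\<integral>\<^sup>+ z. ennreal (diag_dist z powr q') \<partial>\<mu>)"
        using sets by (intro nn_integral_plan_fst[OF \<pi>']) auto
      also have "(\<integral>\<^sup>+ z. ennreal (diag_dist (snd z) powr q') \<partial>\<pi>')
          = (\<integral>\<^sup>+ z. ennreal (diag_dist (snd z) powr q') * indicator upper (snd z) \<partial>\<pi>')"
        using plans_space[OF \<pi>'] by (intro nn_integral_cong)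
          (auto simp: upper_closed_def diag_dist_eq_0 indicator_def)
      also have "\<dots> = (\<integral>\<^sup>+ z. ennreal (diag_dist z powr q') \<partial>\<nu>)"
        using sets by (intro nn_integral_plan_snd[OF \<pi>']) auto
      also have "ennreal (2 powr q') * ((\<integral>\<^sup>+ z. ennreal (diag_dist z powr q') \<partial>\<mu>)
          + (\<integral>\<^sup>+ z. ennreal (diag_dist z powr q') \<partial>\<nu>))
          \<le> ennreal (2 powr q') * (epowr (Pers q \<mu>) q' + epowr (Pers q \<nu>) q')"
        unfolding q'_def using sets less_le_trans[OF zero_less_one q] False
        by (intro mult_left_mono add_mono nn_integral_diag_dist_le_Pers) auto
      \<comment> \<open>Superadditivity of the \<open>q'\<close>-th power merges the two
        persistences into the power of their sum.\<close>
      also have "\<dots> \<le> ennreal (2 powr q') * epowr (Pers q \<mu> + Pers q \<nu>) q'"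
        by (intro mult_left_mono epowr_add_le_add_epowr q'1) auto
      also have "\<dots> = epowr ?B q'"
        using epowr_ennreal[of 2 q'] by (simp only: epowr_mult) simp
      finally show ?thesis .
    qed
    then have "epowr (cost q' \<pi>') ?t \<le> epowr (epowr ?B q') ?t"
      using t_pos by (intro epowr_mono) auto
    also have "epowr (epowr ?B q') ?t = epowr ?B (r * (1 - \<theta>))"
      using q' by (simp add: epowr_epowr)
    finally show ?thesis
      by (simp add: mult_left_mono)
  next
    case True
    \<comment> \<open>With the term of \<open>q\<close> equal to 0, \<open>conj\<close> makes the
      exponent of the \<open>p\<close>-cost equal to 1. It remains to split off \<open>r - p\<close>
      powers of an essentially bounded distance.\<close>
    have p_eq: "r * \<theta> = p"
      using conj True p r by (simp add: field_simps)
    then have r_p: "r * (1 - \<theta>) = r - p" "p \<le> r"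
      using r \<theta> mult_left_le[of \<theta> r] by (simp_all add: algebra_simps)
    obtain b where b: "?B = ennreal b" "0 \<le> b"
      using fin by (cases ?B) (auto simp: ennreal_mult_eq_top_iff)
    have pred: "Measurable.pred borel (\<lambda>x. ennreal (diag_dist x) \<le> P)" for P
      by measurable
    have "AE z in \<pi>'. fst z \<in> upper \<longrightarrow> ennreal (diag_dist (fst z)) \<le> Pers q \<mu>"
      using AE_diag_dist_le_Pers_infinity[OF sets(1)]
      unfolding True AE_plan_fst[OF \<pi>' pred sets(1)] .
    moreover have "AE z in \<pi>'. snd z \<in> upper \<longrightarrow> ennreal (diag_dist (snd z)) \<le> Pers q \<nu>"
      using AE_diag_dist_le_Pers_infinity[OF sets(2)]
      unfolding True AE_plan_snd[OF \<pi>' pred sets(2)] .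
    moreover have "AE z in \<pi>'. fst z \<in> upper_closed \<and> snd z \<in> upper_closed"
      by (rule AE_I2) (simp only: plans_space[OF \<pi>'] mem_Times_iff)
    ultimately have "AE z in \<pi>'. ?d z \<le> b"
      using short
    proof eventually_elim
      case (elim z)
      then have "ennreal (diag_dist (fst z)) \<le> Pers q \<mu>" "ennreal (diag_dist (snd z)) \<le> Pers q \<nu>"
        by (auto simp: upper_closed_def diag_dist_eq_0)
      then have "ennreal (diag_dist (fst z)) + ennreal (diag_dist (snd z)) \<le> Pers q \<mu> + Pers q \<nu>"
        by (rule add_mono)
      \<comment> \<open>Doubling matches the bound obtained for finite \<open>q\<close>.\<close>
      also have "\<dots> \<le> ?B"
        by (simp add: mult_2)
      finally have "diag_dist (fst z) + diag_dist (snd z) \<le> b"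
        using b by (simp add: diag_dist_nonneg flip: ennreal_plus)
      with elim show ?case
        by simp
    qed
    then have "cost r \<pi>' \<le> (\<integral>\<^sup>+ z. ennreal (b powr (r - p)) * ennreal (?d z powr p) \<partial>\<pi>')"
      unfolding cost_def
    proof (intro nn_integral_mono_AE, eventually_elim)
      case (elim z)
      have "?d z powr r = ?d z powr (r - p) * ?d z powr p"
        by (simp flip: powr_add)
      also have "\<dots> \<le> b powr (r - p) * ?d z powr p"
        using elim r_p by (intro mult_right_mono powr_mono2) (auto simp: dist_sup_nonneg)
      finally show ?case
        by (simp add: ennreal_leI flip: ennreal_mult)
    qed
    also have "\<dots> = epowr (cost p \<pi>') (r * \<theta> / p) * epowr ?B (r * (1 - \<theta>))"
      using p_eq p r_p b by (simp add: nn_integral_cmult cost_def epowr_ennreal mult.commute)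
    finally show ?thesis .
  qed
  also have "\<dots> \<le> epowr (cost p \<pi>) (r * \<theta> / p) * epowr ?B (r * (1 - \<theta>))"
    using le s_pos by (intro mult_right_mono epowr_mono) auto
  finally show thesis
    using \<pi>' that by blast
qed

subsection \<open>Interpolation\<close>

text \<open>Solve the inequality for \<open>f a\<close>, pass to the infimum, and transform back; no
  minimiser is chosen. Finiteness of \<open>K\<close> matters: an infimum 0 that is not attained
  would otherwise produce \<open>0 * top = 0\<close> on the right.\<close>

lemma le_epowr_INF_mult:
  fixes y K :: ennreal
  assumes "A \<noteq> {}" "0 < s" "K < \<infinity>" and le: "\<And>a. a \<in> A \<Longrightarrow> y \<le> epowr (f a) s * K"
  shows "y \<le> epowr (INF a \<in> A. f a) s * K"
proof (cases "K = 0")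
  case True
  with assms show ?thesis
    by fastforce
next
  case False
  have K: "x * K / K = x" for x
    using False assms(3) by (simp add: ennreal_mult_divide_eq)
  have "epowr (y / K) (1 / s) \<le> (INF a \<in> A. f a)"
  proof (rule INF_greatest)
    fix a assume "a \<in> A"
    then have "y / K \<le> epowr (f a) s * K / K"
      by (intro divide_right_mono_ennreal le)
    then have "epowr (y / K) (1 / s) \<le> epowr (epowr (f a) s) (1 / s)"
      unfolding K using \<open>0 < s\<close> by (intro epowr_mono) auto
    then show "epowr (y / K) (1 / s) \<le> f a"
      using \<open>0 < s\<close> by (simp add: epowr_epowr)
  qed
  then have "epowr (epowr (y / K) (1 / s)) s \<le> epowr (INF a \<in> A. f a) s"
    using \<open>0 < s\<close> by (intro epowr_mono) auto
  then have "y / K \<le> epowr (INF a \<in> A. f a) s"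
    using \<open>0 < s\<close> by (simp add: epowr_epowr)
  then have "y / K * K \<le> epowr (INF a \<in> A. f a) s * K"
    by (rule mult_right_mono) simp
  moreover have "y / K * K = y"
    using False assms(3) by (simp add: ennreal_divide_times)
  ultimately show ?thesis
    by simp
qed

text \<open>Infimum of \<open>cost_interpolation\<close> over all plans, followed by the
  \<open>r\<close>-th root. The conjugacy is stated over the reals, where an infinite
  \<open>q\<close> contributes 0.\<close>

lemma pdist_interpolation:
  fixes p q r :: ennreal and \<theta> :: real
  assumes sets: "sets \<mu> = sets (restrict_space borel upper)"
      "sets \<nu> = sets (restrict_space borel upper)"
    and fin: "Pers q \<mu> < \<infinity>" "Pers q \<nu> < \<infinity>"
    and p: "1 \<le> p" "p \<noteq> \<infinity>" and q: "1 \<le> q" and r: "0 < r" "r \<noteq> \<infinity>" and \<theta>: "0 < \<theta>" "\<theta> < 1"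
    and conj: "1 / enn2real r = \<theta> / enn2real p + (1 - \<theta>) / enn2real q"
  shows "pdist r \<mu> \<nu> \<le> ennreal (2 powr (1 - \<theta>)) * epowr (pdist p \<mu> \<nu>) \<theta>
    * epowr (Pers q \<mu> + Pers q \<nu>) (1 - \<theta>)"
proof -
  let ?p = "enn2real p" and ?r = "enn2real r" and ?B = "2 * (Pers q \<mu> + Pers q \<nu>)"
  have p': "1 \<le> ?p"
    using p enn2real_mono[of 1 p] by (simp add: less_top)
  have r': "0 < ?r"
    using r by (simp add: enn2real_positive_iff less_top)
  have s_pos: "0 < ?r * \<theta> / ?p"
    using p' r' \<theta> by simp
  let ?I = "INF \<pi> \<in> plans \<mu> \<nu>. cost ?p \<pi>"
  have "(INF \<pi> \<in> plans \<mu> \<nu>. cost ?r \<pi>) \<le> epowr ?I (?r * \<theta> / ?p) * epowr ?B (?r * (1 - \<theta>))"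
  proof (rule le_epowr_INF_mult)
    show "plans \<mu> \<nu> \<noteq> {}"
      using sets by (rule plans_nonempty)
    have "?B \<noteq> top"
      using fin by (simp add: ennreal_mult_eq_top_iff less_top)
    then show "epowr ?B (?r * (1 - \<theta>)) < \<infinity>"
      by (simp add: epowr_eq_top_iff less_top[symmetric] del: distrib_left_numeral)
    fix \<pi> assume "\<pi> \<in> plans \<mu> \<nu>"
    then obtain \<pi>' where "\<pi>' \<in> plans \<mu> \<nu>"
      "cost ?r \<pi>' \<le> epowr (cost ?p \<pi>) (?r * \<theta> / ?p) * epowr ?B (?r * (1 - \<theta>))"
      using cost_interpolation[OF sets fin p' q r' \<theta> conj] by blast
    then show "(INF \<pi> \<in> plans \<mu> \<nu>. cost ?r \<pi>)
        \<le> epowr (cost ?p \<pi>) (?r * \<theta> / ?p) * epowr ?B (?r * (1 - \<theta>))"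
      by (rule INF_lower2)
  qed (fact s_pos)
  then have "pdist r \<mu> \<nu>
      \<le> epowr (epowr ?I (?r * \<theta> / ?p) * epowr ?B (?r * (1 - \<theta>))) (1 / ?r)"
    unfolding pdist_eq_cost[OF r(2)] using r' by (intro epowr_mono) auto
  also have "\<dots> = epowr ?I (\<theta> / ?p) * epowr ?B (1 - \<theta>)"
    unfolding epowr_mult epowr_epowr using r' by simp
  also have "epowr ?B (1 - \<theta>) = ennreal (2 powr (1 - \<theta>)) * epowr (Pers q \<mu> + Pers q \<nu>) (1 - \<theta>)"
    using epowr_ennreal[of 2 "1 - \<theta>"] by (simp only: epowr_mult) simp
  also have "epowr ?I (\<theta> / ?p) = epowr (pdist p \<mu> \<nu>) \<theta>"
    unfolding pdist_eq_cost[OF p(2)] epowr_epowr by simp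
  finally show ?thesis
    by (simp only: ac_simps)
qed

text \<open>The zero measure is a plan. Its support is empty, and a supremum over the empty set is 0
  in \<open>ennreal\<close>.\<close>

lemma Pers_empty_diagram: "Pers q empty_diagram = 0"
proof -
  have null: "null_measure plan_space \<in> plans empty_diagram empty_diagram"
    by (simp add: plans_def empty_diagram_def)
  have supp: "measure_support (null_measure plan_space) = {}"
    unfolding measure_support_def by (auto intro!: exI[of _ UNIV])
  show ?thesis
  proof (cases "q = \<infinity>")
    case True
    have "Pers q empty_diagram \<le> (SUP (x, y) \<in> measure_support (null_measure plan_space). ennreal (dist_sup x y))"
      unfolding Pers_def pdist_def if_P[OF True] using null by (rule INF_lower)
    then show ?thesis
      unfolding supp by (simp add: bot_ennreal)
  next
    case False
    have "(INF \<pi> \<in> plans empty_diagram empty_diagram. cost (enn2real q) \<pi>)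
        \<le> cost (enn2real q) (null_measure plan_space)"
      using null by (rule INF_lower)
    then have "(INF \<pi> \<in> plans empty_diagram empty_diagram. cost (enn2real q) \<pi>) = 0"
      by (simp add: cost_def)
    then show ?thesis
      by (simp add: Pers_def pdist_eq_cost[OF False])
  qed
qed

lemma finite_pers_sets: "\<mu> \<in> finite_pers q \<Longrightarrow> sets \<mu> = sets (restrict_space borel upper)"
  and finite_pers_Pers: "\<mu> \<in> finite_pers q \<Longrightarrow> Pers q \<mu> < \<infinity>"
  by (simp_all add: finite_pers_def persistence_measures_def)

lemma finite_pers_interpolation:
  assumes p: "1 \<le> p" and order: "p < r" "r < q"
  shows "finite_pers p \<inter> finite_pers q \<subseteq> finite_pers r"
proof
  fix \<mu> assume \<mu>: "\<mu> \<in> finite_pers p \<inter> finite_pers q"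
  let ?p = "enn2real p" and ?r = "enn2real r"
  define i where "i = 1 / enn2real q"
  \<comment> \<open>The conjugacy relation solved for \<open>\<theta>\<close>; it lies strictly
    between 0 and 1 because \<open>i < 1 / ?r < 1 / ?p\<close>.\<close>
  define \<theta> where "\<theta> = (1 / ?r - i) / (1 / ?p - i)"
  have fin: "p < \<infinity>" "r < \<infinity>"
    using less_le_trans[OF order(1) top_greatest] less_le_trans[OF order(2) top_greatest] by simp_all
  have p': "1 \<le> ?p"
    using p fin enn2real_mono[of 1 p] by simp
  have pr: "?p < ?r"
    using order fin by (simp add: enn2real_less_iff less_top)
  have "i < 1 / ?r"
  proof (cases "q = \<infinity>")
    case True
    then show ?thesis
      using p' pr by (simp add: i_def)
  next
    case False
    then have "?r < enn2real q"
      using order fin by (cases r; cases q) (auto simp: ennreal_less_iff)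
    then show ?thesis
      using p' pr by (simp add: i_def frac_less2)
  qed
  moreover have "1 / ?r < 1 / ?p"
    using p' pr by (simp add: frac_less2)
  ultimately have \<theta>: "0 < \<theta>" "\<theta> < 1" and conj: "1 / ?r = \<theta> * (1 / ?p - i) + i"
    unfolding \<theta>_def by simp_all
  have "Pers r \<mu> \<le> ennreal (2 powr (1 - \<theta>)) * epowr (Pers p \<mu>) \<theta>
      * epowr (Pers q \<mu> + Pers q empty_diagram) (1 - \<theta>)"
    unfolding Pers_def[of r] Pers_def[of p]
  proof (rule pdist_interpolation)
    show "1 / ?r = \<theta> / ?p + (1 - \<theta>) / enn2real q"
      using conj unfolding i_def by (simp add: algebra_simps diff_divide_distrib)
    show "0 < r"
      using order(1) by (rule le_less_trans[OF zero_le])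
    show "1 \<le> q"
      using p order by auto
  qed (use \<mu> p fin \<theta> in \<open>auto simp: sets_empty_diagram Pers_empty_diagram
      dest: finite_pers_sets finite_pers_Pers\<close>)
  also have "\<dots> < \<infinity>"
    using \<mu>[THEN IntD1, THEN finite_pers_Pers] \<mu>[THEN IntD2, THEN finite_pers_Pers]
    by (simp add: Pers_empty_diagram ennreal_mult_eq_top_iff epowr_eq_top_iff less_top[symmetric])
  finally show "\<mu> \<in> finite_pers r"
    using \<mu> by (simp add: finite_pers_def)
qed

theorem proposition2p41:
  fixes p q :: ennreal
  assumes "1 \<le> p" and "p < q"
  shows "(\<forall>(\<theta>::real) (p\<theta>::ennreal) \<mu> \<nu>.
            0 < \<theta> \<and> \<theta> < 1 \<and> 1 / p\<theta> = ennreal \<theta> / p + ennreal (1 - \<theta>) / q \<and>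
            \<mu> \<in> finite_pers p \<inter> finite_pers q \<and> \<nu> \<in> finite_pers p \<inter> finite_pers q \<longrightarrow>
            pdist p\<theta> \<mu> \<nu> \<le>
              ennreal (2 powr (1 - \<theta>)) * epowr (pdist p \<mu> \<nu>) \<theta> *
              epowr (Pers q \<mu> + Pers q \<nu>) (1 - \<theta>)) \<and>
         (\<forall>r. p \<le> r \<and> r \<le> q \<longrightarrow> finite_pers p \<inter> finite_pers q \<subseteq> finite_pers r)"
proof (intro conjI allI impI)
  fix \<theta> :: real and r :: ennreal and \<mu> \<nu>
  assume asm: "0 < \<theta> \<and> \<theta> < 1 \<and> 1 / r = ennreal \<theta> / p + ennreal (1 - \<theta>) / q \<and>
    \<mu> \<in> finite_pers p \<inter> finite_pers q \<and> \<nu> \<in> finite_pers p \<inter> finite_pers q"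
  then have \<theta>: "0 < \<theta>" "\<theta> < 1" and \<mu>\<nu>: "\<mu> \<in> finite_pers q" "\<nu> \<in> finite_pers q"
    by auto
  obtain p' where p': "p = ennreal p'" "1 \<le> p'"
    using assms by (cases p) (auto simp: ennreal_ge_1)
  have first: "ennreal \<theta> / p = ennreal (\<theta> / p')"
    using \<theta> p' by (simp add: divide_ennreal)
  \<comment> \<open>For \<open>q = top\<close> both sides are 0: the left by division by
    \<open>top\<close>, the right because \<open>enn2real top = 0\<close> and real division by 0
    gives 0.\<close>
  have second: "ennreal (1 - \<theta>) / q = ennreal ((1 - \<theta>) / enn2real q)"
  proof (cases q)
    case (real q')
    with assms p' have "0 < q'"
      by (auto simp: ennreal_less_iff)
    with real \<theta> show ?thesis
      by (simp add: divide_ennreal)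
  qed simp
  let ?c = "\<theta> / p' + (1 - \<theta>) / enn2real q"
  have c: "1 / r = ennreal ?c" "0 < ?c"
    using asm \<theta> p' unfolding first second
    by (auto simp: add_pos_nonneg simp flip: ennreal_plus)
  \<comment> \<open>In \<open>ennreal\<close>, \<open>1 / top = 0\<close> and
    \<open>1 / 0 = top\<close>, while \<open>1 / r\<close> is positive and finite.\<close>
  then have "r \<noteq> top" "r \<noteq> 0"
    by auto
  then obtain r' where r': "r = ennreal r'" "0 < r'"
    by (cases r) (auto simp: less_le)
  then have "1 / r' = ?c"
    using c by (simp add: divide_ennreal flip: ennreal_1)
  then show "pdist r \<mu> \<nu> \<le> ennreal (2 powr (1 - \<theta>)) * epowr (pdist p \<mu> \<nu>) \<theta>
      * epowr (Pers q \<mu> + Pers q \<nu>) (1 - \<theta>)"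
    using r' p' assms order.trans[OF assms(1) less_imp_le[OF assms(2)]] \<theta> \<mu>\<nu>[THEN finite_pers_sets] \<mu>\<nu>[THEN finite_pers_Pers]
    by (intro pdist_interpolation) auto
next
  fix r assume "p \<le> r \<and> r \<le> q"
  then consider "r = p" | "r = q" | "p < r" "r < q"
    by fastforce
  then show "finite_pers p \<inter> finite_pers q \<subseteq> finite_pers r"
    using assms finite_pers_interpolation by cases auto
qed

end
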